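(* Let $\mathcal{X}\subset\mathbb{R}$ be countably infinite and bounded, let $(\lambda_x)_{x\in\mathcal{X}}$ be a fixed family of positive real numbers, and let $(\mathcal{Y}_x)_{x\in\mathcal{X}}$ be independent homogeneous Poisson point processes on $\mathbb{R}$, where $\mathcal{Y}_x$ has intensity $\lambda_x$. Let $$V:=\{(x,y)\in\mathbb{R}^2 \mid x\in\mathcal{X}\Rightarrow y\in\mathcal{Y}_x\}.$$ If $$\forall \varepsilon>0:\quad \sum_{x\in\mathcal{X}}e^{-\lambda_x\varepsilon}<\infty,$$ then $V$ is almost surely path-connected; otherwise $V$ is almost surely not path-connected.
   Context: All random objects are defined on a complete probability space $(\Omega,\mathcal{F},P)$. Each Poisson point process $\mathcal{Y}_x$ is regarded as a random closed (locally finite) subset of $\mathbb{R}$. The set $V$ is path-connected if for all $u,v\in V$ there is a continuous $f:[0,1]\to V$ with $f(0)=u$ and $f(1)=v$. *)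

theory Defs
  imports "HOL-Probability.Probability"
begin

definition locally_finite_sets :: "real set set" where
  "locally_finite_sets = {S. \<forall>B. bounded B \<longrightarrow> finite (S \<inter> B)}"

text \<open>The \<open>\<sigma>\<close>-algebra on configurations is the usual one for simple point processes: the smallest
  one making every counting map \<open>S \<mapsto> card (S \<inter> B)\<close>, for bounded Borel \<open>B\<close>, measurable.\<close>

definition config_space :: "real set measure" where
  "config_space = sigma locally_finite_sets
     {{S \<in> locally_finite_sets. card (S \<inter> B) = k} | B k. B \<in> sets borel \<and> bounded B}"

text \<open>The counting probabilities are written out since the library's \<^const>\<open>poisson_pmf\<close> is only
  specified for positive rates, whereas \<open>B\<close> may be a null set here (with \<open>0 ^ 0 = 1\<close> the formula
  then gives count \<open>0\<close> almost surely). As \<open>B\<close> is bounded, \<^term>\<open>measure lborel B\<close> is its true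
  Lebesgue measure and \<open>card\<close> is applied to finite sets only.\<close>

definition poisson_process :: "'w measure \<Rightarrow> real \<Rightarrow> ('w \<Rightarrow> real set) \<Rightarrow> bool" where
  "poisson_process M r Y \<longleftrightarrow>
     Y \<in> measurable M config_space \<and>
     (\<forall>B k. B \<in> sets borel \<longrightarrow> bounded B \<longrightarrow>
        measure M {\<omega> \<in> space M. card (Y \<omega> \<inter> B) = k} =
          exp (- (r * measure lborel B)) * (r * measure lborel B) ^ k / fact k) \<and>
     (\<forall>(n::nat) B. (\<forall>i<n. B i \<in> sets borel \<and> bounded (B i)) \<longrightarrow>
        disjoint_family_on B {..<n} \<longrightarrow>
        prob_space.indep_vars M (\<lambda>_. count_space UNIV) (\<lambda>i \<omega>. card (Y \<omega> \<inter> B i)) {..<n})"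

definition V_set :: "real set \<Rightarrow> (real \<Rightarrow> real set) \<Rightarrow> (real \<times> real) set" where
  "V_set X Y = {(x, y). x \<in> X \<longrightarrow> y \<in> Y x}"

end

theory Submission imports Defs begin

text \<open>The graph of a continuous \<open>f\<close> with \<open>f x \<in> Y x\<close> for \<open>x \<in> X\<close> is a path in \<open>V\<close>. If all the sums converge, then by Borel--Cantelli, for each \<open>\<epsilon>\<close> and each bounded window,
  all but finitely many \<open>Y x\<close> are \<open>\<epsilon>\<close>-dense in the window. So an approximate selection with error at
  most \<open>2\<^sup>-\<^sup>n\<close> has error above \<open>2\<^sup>-\<^sup>n\<^sup>-\<^sup>1\<close> at finitely many points only, where a perturbation of size at
  most \<open>2\<^sup>-\<^sup>n\<close> repairs it; the limit of these selections is \<open>f\<close>.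

  If the sum diverges for some \<open>\<epsilon>\<close>, then, \<open>X\<close> being bounded, it already diverges over arbitrarily
  short intervals on one fixed side of some point \<open>c\<close>. By independence, almost surely there are, at
  every height and arbitrarily close to \<open>c\<close> on that side, points of \<open>X\<close> whose process has a gap of
  length \<open>\<epsilon>\<close> there. No path can leave the line over \<open>c\<close> towards that side.\<close>

subsection \<open>Continuous selections\<close>

lemma closed_locally_finite:
  assumes "S \<in> locally_finite_sets"
  shows "closed S"
proof -
  have "finite (S \<inter> ball z 1)" for z :: real
    using assms by (auto simp: locally_finite_sets_def)
  then have "\<not> z islimpt S" for z
    unfolding islimpt_eq_infinite_ball using zero_less_one by blast
  then show ?thesis by (simp add: closed_limpt)
qed

text \<open>Cut the window into finitely many cells of length \<open>1 / n < e\<close>: if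
  \<open>y\<close> is farther than \<open>e\<close> from \<open>Y x\<close>, then the cell
  containing \<open>y\<close> misses \<open>Y x\<close>. Cell ends are rational, so
  \<open>hit\<close> is only asked for countably many intervals, which suits almost sure
  statements.\<close>

lemma finite_infdist_gt:
  fixes Y :: "'a \<Rightarrow> real set"
  assumes hit: "\<And>p q. p \<in> \<rat> \<Longrightarrow> q \<in> \<rat> \<Longrightarrow> p < q \<Longrightarrow> finite {x \<in> X. Y x \<inter> {p..q} = {}}"
    and "e > 0"
  shows "finite {x \<in> X. \<exists>y. \<bar>y\<bar> \<le> R \<and> infdist y (Y x) > e}"
proof -
  obtain n :: nat where n: "n > 0" "1 / real n < e"
    using nat_approx_posE[OF \<open>e > 0\<close>] by (metis zero_less_Suc)
  let ?I = "\<lambda>j::int. {of_int j / real n .. (of_int j + 1) / real n}"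
  have "{x \<in> X. \<exists>y. \<bar>y\<bar> \<le> R \<and> infdist y (Y x) > e}
      \<subseteq> (\<Union>j\<in>{\<lfloor>- R * n\<rfloor>..\<lfloor>R * n\<rfloor>}. {x \<in> X. Y x \<inter> ?I j = {}})"
  proof safe
    fix x y assume x: "x \<in> X" and y: "\<bar>y\<bar> \<le> R" "infdist y (Y x) > e"
    define j where "j = \<lfloor>y * n\<rfloor>"
    have "- R * n \<le> y * n" "y * n \<le> R * n"
      using y(1) by (intro mult_right_mono; simp)+
    then have "j \<in> {\<lfloor>- R * n\<rfloor>..\<lfloor>R * n\<rfloor>}"
      unfolding j_def by (auto intro: floor_mono)
    moreover have "Y x \<inter> ?I j = {}"
    proof (rule ccontr)
      assume "Y x \<inter> ?I j \<noteq> {}"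
      then obtain z where z: "z \<in> Y x" "z \<in> ?I j" by blast
      have "of_int j \<le> y * n" "y * n \<le> of_int j + 1"
        unfolding j_def by linarith+
      then have "y \<in> ?I j"
        using n(1) by (simp add: field_simps)
      then have "\<bar>y - z\<bar> \<le> 1 / n"
        using z(2) by (auto simp: add_divide_distrib abs_le_iff)
      then have "infdist y (Y x) \<le> 1 / n"
        using z(1) by (auto intro: infdist_le2 simp: dist_real_def)
      then show False using y(2) n(2) by simp
    qed
    ultimately show "x \<in> (\<Union>j\<in>{\<lfloor>- R * n\<rfloor>..\<lfloor>R * n\<rfloor>}. {x \<in> X. Y x \<inter> ?I j = {}})"
      using x by blast
  qed
  moreover have "finite {x \<in> X. Y x \<inter> ?I j = {}}" for j
    using n(1) by (intro hit) (auto simp: divide_strict_right_mono)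
  then have "finite (\<Union>j\<in>{\<lfloor>- R * n\<rfloor>..\<lfloor>R * n\<rfloor>}. {x \<in> X. Y x \<inter> ?I j = {}})"
    by (intro finite_UN_I finite_atLeastAtMost_int)
  ultimately show ?thesis
    by (rule finite_subset)
qed

text \<open>The deterministic properties that samples have almost surely in the summable case. As
  \<open>infdist\<close> to the empty set is 0, \<open>finite_bad\<close> alone would not notice an
  empty \<open>Y x\<close>.\<close>

context
  fixes X :: "real set" and Y :: "real \<Rightarrow> real set"
  assumes closed_Y: "\<And>x. x \<in> X \<Longrightarrow> closed (Y x)"
    and nonempty_Y: "\<And>x. x \<in> X \<Longrightarrow> Y x \<noteq> {}"
    and finite_bad: "\<And>e R. e > 0 \<Longrightarrow> finite {x \<in> X. \<exists>y. \<bar>y\<bar> \<le> R \<and> infdist y (Y x) > e}"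
begin

text \<open>The correction vanishes at every point where \<open>Y x\<close> has a gap of size \<open>d\<close> in the range of the
  new function but \<open>f x\<close> itself is already \<open>d\<close>-close to \<open>Y x\<close>; so no new bad point can arise.\<close>

lemma refine_approximation:
  fixes f :: "real \<Rightarrow> real"
  assumes f: "continuous_on UNIV f" "\<And>x. \<bar>f x\<bar> \<le> R"
    and close: "\<And>x. x \<in> X \<Longrightarrow> infdist (f x) (Y x) \<le> e"
    and Z: "finite Z" "\<And>z. z \<in> Z \<Longrightarrow> z \<in> X \<Longrightarrow> f z \<in> Y z"
    and "e \<ge> 0" "d > 0"
  obtains g where "continuous_on UNIV g" "\<And>x. \<bar>g x - f x\<bar> \<le> e" "\<And>z. z \<in> Z \<Longrightarrow> g z = f z"
    "\<And>x. x \<in> X \<Longrightarrow> infdist (g x) (Y x) \<le> d"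
proof -
  \<comment> \<open>\<open>E\<close> holds the points to repair. \<open>E'\<close> holds all points
    that could be bad for any function bounded by \<open>R + e\<close>, in particular for the
    corrected one.\<close>
  define E where "E = {x \<in> X. infdist (f x) (Y x) > d}"
  define E' where "E' = {x \<in> X. \<exists>y. \<bar>y\<bar> \<le> R + e \<and> infdist y (Y x) > d}"
  define c where "c x = (if x \<in> E then (SOME y. y \<in> Y x \<and> infdist (f x) (Y x) = dist (f x) y) - f x else 0)" for x
  have c: "c x + f x \<in> Y x \<and> \<bar>c x\<bar> \<le> e" if "x \<in> E" for x
  proof -
    have "x \<in> X" using that by (simp add: E_def)
    then have "\<exists>y. y \<in> Y x \<and> infdist (f x) (Y x) = dist (f x) y"
      using infdist_attains_inf[OF closed_Y nonempty_Y] by metis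
    from someI_ex[OF this] show ?thesis
      using that close[OF \<open>x \<in> X\<close>] by (auto simp: c_def dist_real_def abs_minus_commute)
  qed
  have E: "E \<subseteq> E'" "finite E'"
    using finite_bad[OF \<open>d > 0\<close>] add_increasing2[OF \<open>e \<ge> 0\<close> f(2)]
    unfolding E_def E'_def by auto
  have "E \<inter> Z = {}"
    using Z(2) \<open>d > 0\<close> by (force simp: E_def)
  let ?S = "E' \<union> Z"
  have "finite ?S" using E Z by simp
  \<comment> \<open>A finite set is closed and every function on it is continuous, so Tietze extends
    \<open>c\<close> with the same bound \<open>e\<close>.\<close>
  then have "continuous_on ?S c" "closedin (top_of_set UNIV) ?S"
    by (auto intro: continuous_on_finite finite_imp_closed)
  moreover have "norm (c x) \<le> e" for x
    using c[of x] \<open>e \<ge> 0\<close> by (cases "x \<in> E") (auto simp: c_def)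
  ultimately obtain h where h: "continuous_on UNIV h" "\<And>x. x \<in> ?S \<Longrightarrow> h x = c x"
      "\<And>x. x \<in> UNIV \<Longrightarrow> norm (h x) \<le> e"
    using Tietze[of ?S c UNIV e] \<open>e \<ge> 0\<close> by metis
  show thesis
  proof (rule that[of "\<lambda>x. f x + h x"])
    show "continuous_on UNIV (\<lambda>x. f x + h x)"
      using f(1) h(1) by (intro continuous_intros)
    show "\<bar>f x + h x - f x\<bar> \<le> e" for x
      using h(3)[of x] by simp
    show "f z + h z = f z" if "z \<in> Z" for z
      using that \<open>E \<inter> Z = {}\<close> h(2)[of z] by (auto simp: c_def)
    show "infdist (f x + h x) (Y x) \<le> d" if "x \<in> X" for x
    proof (cases "x \<in> E'")
      case True
      then have hx: "h x = c x" by (simp add: h)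
      show ?thesis
      proof (cases "x \<in> E")
        case True
        then show ?thesis using c[OF True] \<open>d > 0\<close> by (simp add: hx add.commute)
      next
        case False
        then show ?thesis using that by (simp add: hx c_def E_def)
      qed
    next
      case False
      have "\<bar>f x + h x\<bar> \<le> R + e"
        using f(2)[of x] h(3)[of x] by simp
      then show ?thesis using False that by (force simp: E'_def)
    qed
  qed
qed

text \<open>Refinement with tolerances \<open>(1/2) ^ n\<close> changes the function by a summable
  amount, so the iterates converge uniformly. In the limit the distance to each closed
  \<open>Y x\<close> is 0. The set \<open>Z\<close> serves to pin the ends of a path.\<close>

lemma continuous_selection:
  assumes "finite Z" and v: "\<And>z. z \<in> Z \<Longrightarrow> z \<in> X \<Longrightarrow> v z \<in> Y z"
  obtains f :: "real \<Rightarrow> real" where "continuous_on UNIV f"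
    "\<And>z. z \<in> Z \<Longrightarrow> f z = v z" "\<And>x. x \<in> X \<Longrightarrow> f x \<in> Y x"
proof -
  define B where "B = (\<Sum>z\<in>Z. \<bar>v z\<bar>)"
  have "norm (v z) \<le> B" if "z \<in> Z" for z
    unfolding B_def using member_le_sum[of z Z "\<lambda>z. \<bar>v z\<bar>"] that \<open>finite Z\<close> by simp
  moreover have "B \<ge> 0" by (simp add: B_def sum_nonneg)
  moreover have "continuous_on Z v" "closedin (top_of_set UNIV) Z"
    using \<open>finite Z\<close> by (auto intro: continuous_on_finite finite_imp_closed)
  ultimately obtain f0 where f0: "continuous_on UNIV f0" "\<And>z. z \<in> Z \<Longrightarrow> f0 z = v z"
      "\<And>x. x \<in> UNIV \<Longrightarrow> norm (f0 x) \<le> B"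
    using Tietze[of Z v UNIV B] by metis
  \<comment> \<open>The first error only has to be bounded uniformly: off the finite set
    \<open>E\<close> it is at most 1, and on \<open>E\<close> the sum in \<open>e\<close> dominates
    it.\<close>
  define E where "E = {x \<in> X. \<exists>y. \<bar>y\<bar> \<le> B \<and> infdist y (Y x) > 1}"
  define e where "e = 1 + (\<Sum>x\<in>E. infdist (f0 x) (Y x))"
  have "finite E" unfolding E_def by (rule finite_bad) simp
  have "infdist (f0 x) (Y x) \<le> e" if "x \<in> X" for x
  proof (cases "x \<in> E")
    case True
    then show ?thesis
      unfolding e_def using member_le_sum[of x E "\<lambda>x. infdist (f0 x) (Y x)"] \<open>finite E\<close>
      by (simp add: infdist_nonneg)
  next
    case False
    then have "infdist (f0 x) (Y x) \<le> 1"
      using that f0(3)[of x] by (force simp: E_def)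
    also have "1 \<le> e" by (simp add: e_def sum_nonneg infdist_nonneg)
    finally show ?thesis .
  qed
  moreover have "e \<ge> 0" by (simp add: e_def add_nonneg_nonneg sum_nonneg infdist_nonneg)
  moreover have "f0 z \<in> Y z" if "z \<in> Z" "z \<in> X" for z
    using f0(2) v that by simp
  ultimately obtain f1 where f1: "continuous_on UNIV f1" "\<And>x. \<bar>f1 x - f0 x\<bar> \<le> e"
      "\<And>z. z \<in> Z \<Longrightarrow> f1 z = f0 z" "\<And>x. x \<in> X \<Longrightarrow> infdist (f1 x) (Y x) \<le> 1"
    using refine_approximation[of f0 B e Z 1] f0 \<open>finite Z\<close> by (metis UNIV_I real_norm_def zero_less_one)
  \<comment> \<open>The invariant includes boundedness because each refinement needs some bound
    \<open>R\<close>; this bound may change with \<open>n\<close>.\<close>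
  define P where "P n f \<longleftrightarrow> continuous_on UNIV f \<and> (\<exists>R. \<forall>x. \<bar>f x\<bar> \<le> R) \<and> (\<forall>z\<in>Z. f z = v z) \<and>
      (\<forall>x\<in>X. infdist (f x) (Y x) \<le> (1/2) ^ n)" for n and f :: "real \<Rightarrow> real"
  have "\<bar>f1 x\<bar> \<le> B + e" for x
    using f1(2)[of x] f0(3)[of x] by simp
  then have P0: "P 0 f1"
    using f1 f0 by (auto simp: P_def)
  have PSuc: "\<exists>g. P (Suc n) g \<and> (\<forall>x. \<bar>g x - f x\<bar> \<le> (1/2) ^ n)" if Pf: "P n f" for n f
  proof -
    obtain R where R: "\<And>x. \<bar>f x\<bar> \<le> R" using Pf by (auto simp: P_def)
    obtain g where g: "continuous_on UNIV g" "\<And>x. \<bar>g x - f x\<bar> \<le> (1/2) ^ n"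
        "\<And>z. z \<in> Z \<Longrightarrow> g z = f z" "\<And>x. x \<in> X \<Longrightarrow> infdist (g x) (Y x) \<le> (1/2) ^ Suc n"
      using Pf R v \<open>finite Z\<close>
      by (auto simp: P_def intro: refine_approximation[of f R "(1/2)^n" Z "(1/2) ^ Suc n"])
    have "\<bar>g x\<bar> \<le> R + (1/2) ^ n" for x
      using g(2)[of x] R[of x] by linarith
    then have "P (Suc n) g"
      using g Pf unfolding P_def by auto
    then show ?thesis using g(2) by blast
  qed
  obtain F where F: "\<And>n. P n (F n)" "\<And>n x. \<bar>F (Suc n) x - F n x\<bar> \<le> (1/2) ^ n"
    using dependent_nat_choice[of P "\<lambda>n f g. \<forall>x. \<bar>g x - f x\<bar> \<le> (1/2) ^ n"] P0 PSuc by blast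
  have "uniformly_convergent_on UNIV (\<lambda>n x. \<Sum>i<n. F (Suc i) x - F i x)"
    using F(2) by (intro Weierstrass_m_test'[of _ _ "\<lambda>n. (1/2) ^ n"]) auto
  then obtain G where "uniform_limit UNIV (\<lambda>n x. \<Sum>i<n. F (Suc i) x - F i x) G sequentially"
    by (auto simp: uniformly_convergent_on_def)
  moreover have "(\<Sum>i<n. F (Suc i) x - F i x) = F n x - F 0 x" for n x
    using sum_lessThan_telescope[of "\<lambda>i. F i x"] by simp
  ultimately have "uniform_limit UNIV (\<lambda>n x. F n x - F 0 x) G sequentially"
    by simp
  from uniform_limit_add[OF this uniform_limit_const[where c = "F 0" and S = UNIV]]
  have lim: "uniform_limit UNIV F (\<lambda>x. G x + F 0 x) sequentially"
    by simp
  have plim: "(\<lambda>n. F n x) \<longlonglongrightarrow> G x + F 0 x" for x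
    using tendsto_uniform_limitI[OF lim] by simp
  show thesis
  proof (rule that[of "\<lambda>x. G x + F 0 x"])
    show "continuous_on UNIV (\<lambda>x. G x + F 0 x)"
      using F(1) by (intro uniform_limit_theorem[OF _ lim]) (auto simp: P_def)
    show "G z + F 0 z = v z" if "z \<in> Z" for z
    proof -
      have "(\<lambda>n. F n z) \<longlonglongrightarrow> v z"
        using F(1) that by (simp add: P_def)
      then show ?thesis using plim LIMSEQ_unique by blast
    qed
    show "G x + F 0 x \<in> Y x" if "x \<in> X" for x
    proof -
      have "(\<lambda>n. infdist (F n x) (Y x)) \<longlonglongrightarrow> infdist (G x + F 0 x) (Y x)"
        by (intro tendsto_infdist plim)
      moreover have "(\<lambda>n. (1/2) ^ n :: real) \<longlonglongrightarrow> 0"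
        by (intro LIMSEQ_realpow_zero) auto
      ultimately have "infdist (G x + F 0 x) (Y x) \<le> 0"
        using F(1) that by (intro LIMSEQ_le) (auto simp: P_def)
      then have "infdist (G x + F 0 x) (Y x) = 0"
        using infdist_nonneg by (rule antisym)
      then show ?thesis
        using in_closed_iff_infdist_zero[OF closed_Y[OF that] nonempty_Y[OF that]] by blast
    qed
  qed
qed

text \<open>The path runs along the graph of a selection through both points; a graph can pass
  through both only because their abscissae differ.\<close>

lemma path_component_V_set:
  assumes "(a, u) \<in> V_set X Y" "(b, w) \<in> V_set X Y" "a \<noteq> b"
  shows "path_component (V_set X Y) (a, u) (b, w)"
proof -
  have "(if z = a then u else w) \<in> Y z" if "z \<in> {a, b}" "z \<in> X" for z
    using that assms by (auto simp: V_set_def)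
  then obtain f where f: "continuous_on UNIV f" "\<And>z. z \<in> {a, b} \<Longrightarrow> f z = (if z = a then u else w)"
      "\<And>x. x \<in> X \<Longrightarrow> f x \<in> Y x"
    using continuous_selection[of "{a, b}" "\<lambda>z. if z = a then u else w"] by blast
  let ?g = "\<lambda>t. (a + t * (b - a), f (a + t * (b - a)))"
  have "path ?g"
    unfolding path_def by (intro continuous_intros continuous_on_compose2[OF f(1)]) auto
  moreover have "path_image ?g \<subseteq> V_set X Y"
    using f(3) by (auto simp: path_image_def V_set_def)
  moreover have "pathstart ?g = (a, u)" "pathfinish ?g = (b, w)"
    using f(2)[of a] f(2)[of b] \<open>a \<noteq> b\<close> by (auto simp: pathstart_def pathfinish_def)
  ultimately show ?thesis
    by (auto simp: path_component_def)
qed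

text \<open>Two points may share their abscissa, so the connection goes through a third point over
  some \<open>z\<close> other than \<open>a\<close> and \<open>b\<close>. Outside the countable
  \<open>X\<close> the whole vertical line belongs to \<open>V_set X Y\<close>.\<close>

lemma path_connected_V_set:
  assumes "countable X"
  shows "path_connected (V_set X Y)"
  unfolding path_connected_component
proof safe
  fix a u b w assume V: "(a, u) \<in> V_set X Y" "(b, w) \<in> V_set X Y"
  have "countable (insert a (insert b X))" using assms by simp
  then obtain z where z: "z \<notin> insert a (insert b X)"
    using uncountable_UNIV_real by (metis UNIV_eq_I)
  then have "(z, 0) \<in> V_set X Y" by (simp add: V_set_def)
  then show "path_component (V_set X Y) (a, u) (b, w)"
    using V z by (blast intro: path_component_trans path_component_V_set)
qed

end

subsection \<open>Obstructed paths\<close>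

text \<open>Watch a path crossing the line \<open>x = c\<close> for the last time: right after that moment it sweeps all
  abscissae on one side of \<open>c\<close> while its height barely changes, hence it runs into a gap.\<close>

lemma not_path_connected_V_set:
  fixes c s e :: real
  assumes "countable X" "\<bar>s\<bar> = 1" "e > 0"
    and gap: "\<And>y d. d > 0 \<Longrightarrow> \<exists>x\<in>X. 0 < s * (x - c) \<and> s * (x - c) < d \<and> Y x \<inter> {y - e..y + e} = {}"
  shows "\<not> path_connected (V_set X Y)"
proof
  assume pc: "path_connected (V_set X Y)"
  \<comment> \<open>Rays are uncountable, so on either side of \<open>c\<close> there is an abscissa
    outside \<open>X\<close>, where height 0 is allowed. These give the two points that no path can
    join.\<close>
  have avoid: "\<exists>t>0. c + r * t \<notin> X" if "r \<noteq> 0" for r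
  proof (rule ccontr)
    assume "\<not> ?thesis"
    then have "(\<lambda>t. c + r * t) ` {0<..} \<subseteq> X" by auto
    moreover have "inj_on (\<lambda>t. c + r * t) {0<..}" using that by (auto simp: inj_on_def)
    ultimately have "countable {0::real<..}"
      using \<open>countable X\<close> countable_subset countable_image_inj_on by blast
    then have "countable {0::real<..<1}"
      by (rule countable_subset[rotated]) auto
    then show False using uncountable_open_interval[of 0 "1::real"] by simp
  qed
  have s: "s \<noteq> 0" "s * s = 1" using \<open>\<bar>s\<bar> = 1\<close> by (auto simp: abs_if split: if_splits)
  obtain ta where ta: "ta > 0" "c + - s * ta \<notin> X" using avoid[of "- s"] s by auto
  obtain tb where tb: "tb > 0" "c + s * tb \<notin> X" using avoid[of s] s by auto
  have "(c + - s * ta, 0) \<in> V_set X Y" "(c + s * tb, 0) \<in> V_set X Y"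
    using ta tb by (auto simp: V_set_def)
  then obtain g where g: "path g" "path_image g \<subseteq> V_set X Y"
      "pathstart g = (c + - s * ta, 0)" "pathfinish g = (c + s * tb, 0)"
    using pc unfolding path_connected_def by blast
  \<comment> \<open>Signed horizontal distance from the line over \<open>c\<close>, positive on the
    side with the gaps.\<close>
  define q where "q t = s * (fst (g t) - c)" for t
  have cont: "continuous_on {0..1} g" using g(1) by (simp add: path_def)
  have cq: "continuous_on {0..1} q"
    unfolding q_def by (intro continuous_intros cont)
  have q01: "q 0 = - ta" "q 1 = tb"
    using g(3,4) s(2) by (auto simp: q_def pathstart_def pathfinish_def algebra_simps)
  define K where "K = {t \<in> {0..1}. q t = 0}"
  have "compact K"
  proof -
    have "closed K"
      unfolding K_def by (intro continuous_closed_preimage_constant cq) auto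
    then show ?thesis
      by (rule compact_eq_bounded_closed[THEN iffD2, OF conjI, rotated])
        (auto simp: K_def intro: bounded_subset[of "{0..1::real}"])
  qed
  moreover have "K \<noteq> {}"
    using IVT'[of q 0 0 1] q01 ta tb cq by (auto simp: K_def)
  ultimately obtain t0 where t0: "t0 \<in> K" "\<And>t. t \<in> K \<Longrightarrow> t \<le> t0"
    using compact_attains_sup[of K] by blast
  have "t0 \<noteq> 1" using t0(1) q01 tb by (auto simp: K_def)
  then have t0': "0 \<le> t0" "t0 < 1" "q t0 = 0"
    using t0(1) by (auto simp: K_def)
  have "continuous_on {0..1} (\<lambda>t. snd (g t))"
    by (intro continuous_intros cont)
  then obtain d where d: "d > 0" "\<And>t. t \<in> {0..1} \<Longrightarrow> dist t t0 < d \<Longrightarrow> dist (snd (g t)) (snd (g t0)) < e"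
    using t0' \<open>e > 0\<close> unfolding continuous_on_iff by (metis atLeastAtMost_iff less_imp_le)
  \<comment> \<open>The minimum keeps \<open>t1\<close> in the parameter interval;
    \<open>d / 2\<close> keeps it strictly inside the window where the height varies by less than
    \<open>e\<close>.\<close>
  define t1 where "t1 = min 1 (t0 + d / 2)"
  have t1: "t0 < t1" "t1 \<le> 1" "t1 \<le> t0 + d / 2" using t0' d(1) by (auto simp: t1_def)
  have "q t1 > 0"
  proof (rule ccontr)
    assume "\<not> q t1 > 0"
    moreover have "continuous_on {t1..1} q"
      by (rule continuous_on_subset[OF cq]) (use t0' t1 in auto)
    ultimately obtain t where "t1 \<le> t" "t \<le> 1" "q t = 0"
      using IVT'[of q t1 0 1] q01 tb t1 by auto
    then have "t \<in> K" using t0' t1 by (auto simp: K_def)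
    then show False using t0(2) \<open>t1 \<le> t\<close> t1 by fastforce
  qed
  \<comment> \<open>The gap is requested around the height at time \<open>t0\<close>, at an abscissa
    the path must cross between \<open>t0\<close> and \<open>t1\<close>.\<close>
  from gap[OF this, of "snd (g t0)"] obtain x where x: "x \<in> X" "0 < s * (x - c)" "s * (x - c) < q t1"
    "Y x \<inter> {snd (g t0) - e..snd (g t0) + e} = {}" by blast
  have "continuous_on {t0..t1} q"
    by (rule continuous_on_subset[OF cq]) (use t0' t1 in auto)
  then obtain t where t: "t0 \<le> t" "t \<le> t1" "q t = s * (x - c)"
    using IVT'[of q t0 "s * (x - c)" t1] x t0' t1 by auto
  then have "fst (g t) = x" using s(1) by (simp add: q_def)
  moreover have "t \<in> {0..1}" using t t0' t1 by auto
  moreover from this have "g t \<in> V_set X Y" using g(2) by (auto simp: path_image_def)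
  ultimately have "snd (g t) \<in> Y x"
    using x(1) by (auto simp: V_set_def)
  moreover have "dist (snd (g t)) (snd (g t0)) < e"
    using \<open>t \<in> {0..1}\<close> t t1 d(1) by (intro d(2)) (auto simp: dist_real_def)
  ultimately show False
    using x(4) by (auto simp: dist_real_def abs_less_iff disjoint_iff)
qed

subsection \<open>Summability and Borel--Cantelli\<close>

lemma summable_on_Un:
  fixes f :: "'a \<Rightarrow> 'b::banach"
  assumes "f summable_on A" "f summable_on B"
  shows "f summable_on (A \<union> B)"
  using summable_on_Un_disjoint[OF assms(1) summable_on_subset_banach[OF assms(2)], of "B - A"]
  by auto

lemma summable_on_UN:
  fixes f :: "'a \<Rightarrow> 'b::banach"
  assumes "finite I" "\<And>i. i \<in> I \<Longrightarrow> f summable_on (A i)"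
  shows "f summable_on (\<Union>i\<in>I. A i)"
  using assms by (induction I rule: finite_induct) (auto intro: summable_on_Un)

text \<open>Compactness: if every point had summable neighbourhoods on both sides, adding the single
  term at the point would give a ball with summable trace on \<open>X\<close>, and finitely many
  such balls cover \<open>closure X\<close>. The sign \<open>s\<close> encodes the side.\<close>

lemma not_summable_on_one_sided:
  fixes f :: "real \<Rightarrow> 'b::banach"
  assumes "bounded X" and "\<not> f summable_on X"
  obtains c s where "\<bar>s\<bar> = 1"
    "\<And>d. d > 0 \<Longrightarrow> \<not> f summable_on {x \<in> X. 0 < s * (x - c) \<and> s * (x - c) < d}"
proof (rule ccontr)
  assume "\<not> thesis"
  with that have "\<forall>c s. \<bar>s\<bar> = 1 \<longrightarrow> (\<exists>d>0. f summable_on {x \<in> X. 0 < s * (x - c) \<and> s * (x - c) < d})"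
    by blast
  then have side: "\<exists>d>0. f summable_on {x \<in> X. 0 < s * (x - c) \<and> s * (x - c) < d}" if "\<bar>s\<bar> = 1" for c s
    using that by blast
  have "\<exists>d>0. f summable_on (X \<inter> ball c d)" for c
  proof -
    obtain d1 where d1: "d1 > 0" "f summable_on {x \<in> X. 0 < x - c \<and> x - c < d1}"
      using side[of 1 c] by auto
    obtain d2 where d2: "d2 > 0" "f summable_on {x \<in> X. 0 < c - x \<and> c - x < d2}"
      using side[of "-1" c] by auto
    have "f summable_on {c} \<union> {x \<in> X. 0 < x - c \<and> x - c < d1} \<union> {x \<in> X. 0 < c - x \<and> c - x < d2}"
      using d1 d2 by (intro summable_on_Un) auto
    then have "f summable_on (X \<inter> ball c (min d1 d2))"
      by (rule summable_on_subset_banach) (auto simp: dist_real_def)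
    then show ?thesis using d1 d2 by (intro exI[of _ "min d1 d2"]) auto
  qed
  then obtain d where d: "\<And>c. d c > 0" "\<And>c. f summable_on (X \<inter> ball c (d c))"
    by metis
  have "compact (closure X)" using \<open>bounded X\<close> by (simp add: compact_closure)
  then obtain T where T: "finite T" "closure X \<subseteq> (\<Union>c\<in>T. ball c (d c))"
  proof (rule compactE_image)
    show "closure X \<subseteq> (\<Union>c\<in>UNIV. ball c (d c))"
      using d(1) by (auto simp del: UN_ball_bex_simps intro!: exI centre_in_ball[THEN iffD2])
  qed auto
  have "f summable_on (\<Union>c\<in>T. X \<inter> ball c (d c))"
    by (intro summable_on_UN T d)
  moreover have "(\<Union>c\<in>T. X \<inter> ball c (d c)) = X"
    using T(2) closure_subset[of X] by blast
  ultimately show False using assms(2) by simp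
qed

lemma (in prob_space) borel_cantelli_countable:
  assumes "countable I" "\<And>i. i \<in> I \<Longrightarrow> A i \<in> events"
    and sum: "(\<lambda>i. prob (A i)) summable_on I"
  shows "AE \<omega> in M. finite {i \<in> I. \<omega> \<in> A i}"
proof (cases "finite I")
  case False
  let ?f = "from_nat_into I"
  have bij: "bij_betw ?f UNIV I"
    using assms(1) False by (rule bij_betw_from_nat_into)
  then have fI: "?f n \<in> I" for n by (auto simp: bij_betw_def)
  have "(\<lambda>n. prob (A (?f n))) summable_on UNIV"
    using summable_on_reindex_bij_betw[OF bij, of "\<lambda>i. prob (A i)"] sum by simp
  then have "summable (\<lambda>n. prob (A (?f n)))"
    by (rule summable_on_imp_summable)
  then have "AE \<omega> in M. eventually (\<lambda>n. \<omega> \<in> space M - A (?f n)) sequentially"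
    using assms(2) fI by (intro borel_cantelli_AE1) (auto simp: emeasure_eq_measure)
  then show ?thesis
  proof eventually_elim
    case (elim \<omega>)
    then obtain N where "\<And>n. n \<ge> N \<Longrightarrow> \<omega> \<notin> A (?f n)"
      by (auto simp: eventually_sequentially)
    then have "{n. \<omega> \<in> A (?f n)} \<subseteq> {..<N}" by (force simp: not_le[symmetric])
    moreover have "{i \<in> I. \<omega> \<in> A i} = ?f ` {n. \<omega> \<in> A (?f n)}"
      using bij by (auto simp: bij_betw_def)
    ultimately show ?case by (simp add: finite_subset)
  qed
qed auto

text \<open>A weak second Borel-Cantelli lemma: all events indexed by a finite \<open>J\<close> fail
  with probability at most \<open>exp (- sum p J)\<close>, and these sums are unbounded. One hit
  suffices, since it is later applied to arbitrarily short intervals.\<close>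

lemma (in prob_space) indep_vars_AE_hit:
  assumes indep: "indep_vars N Y I" and C: "\<And>i. i \<in> I \<Longrightarrow> C i \<in> sets (N i)"
    and sum: "\<not> (\<lambda>i. prob (Y i -` C i \<inter> space M)) summable_on I"
  shows "AE \<omega> in M. \<exists>i\<in>I. Y i \<omega> \<in> C i"
proof -
  define p where "p = (\<lambda>i. prob (Y i -` C i \<inter> space M))"
  define D where "D i = Y i -` (space (N i) - C i) \<inter> space M" for i
  have Y: "Y i \<in> measurable M (N i)" if "i \<in> I" for i
    using indep that by (auto simp: indep_vars_def)
  have D: "D i = space M - (Y i -` C i \<inter> space M)" if "i \<in> I" for i
    using measurable_space[OF Y[OF that]] by (auto simp: D_def)
  have D_ev: "D i \<in> events" if "i \<in> I" for i
    unfolding D_def using Y[OF that] C[OF that] by (intro measurable_sets) auto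
  have probD: "prob (D i) = 1 - p i" if "i \<in> I" for i
    unfolding D[OF that] p_def using Y[OF that] C[OF that] by (intro prob_compl measurable_sets)
  have bound: "prob (\<Inter>i\<in>J. D i) \<le> exp (- sum p J)" if J: "finite J" "J \<subseteq> I" "J \<noteq> {}" for J
  proof -
    have "prob (\<Inter>i\<in>J. D i) = (\<Prod>i\<in>J. prob (D i))"
      unfolding D_def using J C by (intro indep_varsD[OF indep]) auto
    also have "\<dots> \<le> (\<Prod>i\<in>J. exp (- p i))"
    proof (intro prod_mono conjI)
      fix i assume "i \<in> J"
      then have "prob (D i) = 1 - p i" using J probD by auto
      then show "prob (D i) \<le> exp (- p i)" using exp_ge_add_one_self[of "- p i"] by simp
    qed simp
    also have "\<dots> = exp (- sum p J)"
      using J by (simp add: exp_sum sum_negf[symmetric])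
    finally show ?thesis .
  qed
  \<comment> \<open>The terms are nonnegative, so failure of summability means unbounded finite
    sums.\<close>
  have "\<exists>J. J \<subseteq> I \<and> finite J \<and> sum p J > real n" for n
  proof (rule ccontr)
    assume "\<not> ?thesis"
    then have "bdd_above (sum p ` {F. F \<subseteq> I \<and> finite F})"
      by (intro bdd_aboveI[of _ "real n"]) (auto simp: not_less)
    then have "p summable_on I"
      by (intro nonneg_bdd_above_summable_on) (auto simp: p_def)
    with sum show False by (simp add: p_def)
  qed
  then obtain J where J: "\<And>n. J n \<subseteq> I" "\<And>n. finite (J n)" "\<And>n. sum p (J n) > real n"
    by metis
  \<comment> \<open>An empty intersection would be the whole type rather than
    \<open>space M\<close>.\<close>
  have J0: "J n \<noteq> {}" for n using J(3)[of n] by (auto dest: sym)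
  let ?N = "\<Inter>n. \<Inter>i\<in>J n. D i"
  have ev: "(\<Inter>i\<in>J n. D i) \<in> events" for n
    using J(1,2) J0 D_ev by (intro sets.finite_INT) blast+
  have N_ev: "?N \<in> events" using ev by (intro sets.countable_INT) auto
  have "prob ?N \<le> exp (- real n)" for n
  proof -
    have "prob ?N \<le> prob (\<Inter>i\<in>J n. D i)" using ev by (intro finite_measure_mono) auto
    also have "\<dots> \<le> exp (- sum p (J n))" using J J0 by (intro bound)
    also have "\<dots> \<le> exp (- real n)" using J(3)[of n] by simp
    finally show ?thesis .
  qed
  moreover have "(\<lambda>n. exp (- real n)) \<longlonglongrightarrow> 0"
    by (rule filterlim_compose[OF exp_at_bot])
       (simp add: filterlim_uminus_at_bot filterlim_real_sequentially)
  ultimately have "prob ?N \<le> 0"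
    by (intro LIMSEQ_le_const[of _ 0]) auto
  then have "?N \<in> null_sets M"
    using N_ev by (simp add: null_sets_def emeasure_eq_measure measure_le_0_iff)
  then show ?thesis
  proof (rule AE_I')
    show "{\<omega> \<in> space M. \<not> (\<exists>i\<in>I. Y i \<omega> \<in> C i)} \<subseteq> ?N"
    proof safe
      fix \<omega> n i assume "\<omega> \<in> space M" "i \<in> J n" "\<not> (\<exists>i\<in>I. Y i \<omega> \<in> C i)"
      moreover have "i \<in> I" using \<open>i \<in> J n\<close> J(1) by blast
      ultimately show "\<omega> \<in> D i" by (simp add: D)
    qed
  qed
qed

subsection \<open>Gaps of Poisson processes\<close>

definition gap_configs :: "real \<Rightarrow> real \<Rightarrow> real set set" where
  "gap_configs p q = {S \<in> locally_finite_sets. S \<inter> {p..q} = {}}"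

text \<open>\<open>card\<close> is 0 on infinite sets too; local finiteness excludes these, so a gap
  is one of the generating counting events, with count 0.\<close>

lemma gap_configs_eq_card: "gap_configs p q = {S \<in> locally_finite_sets. card (S \<inter> {p..q}) = 0}"
proof -
  have "card (S \<inter> {p..q}) = 0 \<longleftrightarrow> S \<inter> {p..q} = {}" if "S \<in> locally_finite_sets" for S
    using that by (simp add: locally_finite_sets_def)
  then show ?thesis by (auto simp: gap_configs_def)
qed

lemma sets_gap_configs: "gap_configs p q \<in> sets config_space"
  unfolding config_space_def gap_configs_eq_card
  by (intro in_measure_of) auto

lemma space_config_space: "space config_space = locally_finite_sets"
  unfolding config_space_def by (intro space_measure_of) auto

lemma poisson_process_locally_finite:
  assumes "poisson_process M r Y" "\<omega> \<in> space M"
  shows "Y \<omega> \<in> locally_finite_sets"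
  using assms measurable_space[of Y M config_space \<omega>]
  by (auto simp: poisson_process_def space_config_space)

lemma measure_gap_configs:
  assumes P: "poisson_process M r Y" and "p \<le> q"
  shows "measure M (Y -` gap_configs p q \<inter> space M) = exp (- (r * (q - p)))"
proof -
  have "Y -` gap_configs p q \<inter> space M = {\<omega> \<in> space M. card (Y \<omega> \<inter> {p..q}) = 0}"
    using poisson_process_locally_finite[OF P] by (auto simp: gap_configs_eq_card)
  then have "measure M (Y -` gap_configs p q \<inter> space M)
      = exp (- (r * measure lborel {p..q})) * (r * measure lborel {p..q}) ^ 0 / fact 0"
    using P by (simp only: poisson_process_def) auto
  then show ?thesis using \<open>p \<le> q\<close> by simp
qed

text \<open>An empty configuration misses every \<open>{0..real n}\<close>, which has probability
  \<open>exp (- (r * real n))\<close>, tending to 0.\<close>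

lemma (in prob_space) poisson_process_AE_nonempty:
  assumes P: "poisson_process M r Y" and "r > 0"
  shows "AE \<omega> in M. Y \<omega> \<noteq> {}"
proof -
  let ?A = "\<lambda>n. Y -` gap_configs 0 (real n) \<inter> space M"
  have ev: "?A n \<in> events" for n
    using P by (intro measurable_sets[OF _ sets_gap_configs]) (simp add: poisson_process_def)
  have "prob (\<Inter>n. ?A n) \<le> exp (- (r * real n))" for n
    using finite_measure_mono[of "\<Inter>n. ?A n" "?A n"] ev measure_gap_configs[OF P, of 0 "real n"] by auto
  moreover have "filterlim (\<lambda>n. - (r * real n)) at_bot sequentially"
    unfolding filterlim_uminus_at_bot using \<open>r > 0\<close>
    by (simp add: filterlim_tendsto_pos_mult_at_top[OF tendsto_const _ filterlim_real_sequentially])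
  then have "(\<lambda>n. exp (- (r * real n))) \<longlonglongrightarrow> 0"
    by (rule filterlim_compose[OF exp_at_bot])
  ultimately have "prob (\<Inter>n. ?A n) \<le> 0"
    by (intro LIMSEQ_le_const[of _ 0]) auto
  moreover have "(\<Inter>n. ?A n) \<in> events"
    using ev by (intro sets.countable_INT) auto
  ultimately have "(\<Inter>n. ?A n) \<in> null_sets M"
    by (intro null_setsI) (simp_all add: emeasure_eq_measure measure_le_0_iff)
  then show ?thesis
    by (rule AE_I') (use poisson_process_locally_finite[OF P] in \<open>auto simp: gap_configs_def\<close>)
qed

section \<open>The dichotomy for Poisson processes, by way of countably many rational
  parameters\<close>

theorem theorem1:
  fixes M :: "'w measure" and X :: "real set" and l :: "real \<Rightarrow> real"
    and Y :: "real \<Rightarrow> 'w \<Rightarrow> real set"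
  assumes "prob_space M" and "complete_measure M"
    and "countable X" and "infinite X" and "bounded X"
    and "\<And>x. x \<in> X \<Longrightarrow> l x > 0"
    and "\<And>x. x \<in> X \<Longrightarrow> poisson_process M (l x) (Y x)"
    and "prob_space.indep_vars M (\<lambda>_. config_space) Y X"
  shows "((\<forall>\<epsilon>>0. (\<lambda>x. exp (- l x * \<epsilon>)) summable_on X) \<longrightarrow>
            (AE \<omega> in M. path_connected (V_set X (\<lambda>x. Y x \<omega>)))) \<and>
         (\<not> (\<forall>\<epsilon>>0. (\<lambda>x. exp (- l x * \<epsilon>)) summable_on X) \<longrightarrow>
            (AE \<omega> in M. \<not> path_connected (V_set X (\<lambda>x. Y x \<omega>))))"
proof (intro conjI impI)
  interpret prob_space M by fact
  note P = assms(7)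
  have lf: "Y x \<omega> \<in> locally_finite_sets" if "\<omega> \<in> space M" "x \<in> X" for \<omega> x
    using poisson_process_locally_finite[OF P] that by blast
  have gap_prob: "prob (Y x -` gap_configs p q \<inter> space M) = exp (- l x * (q - p))"
    if "x \<in> X" "p \<le> q" for x p q
    using measure_gap_configs[OF P] that by simp
  {
    assume sum: "\<forall>\<epsilon>>0. (\<lambda>x. exp (- l x * \<epsilon>)) summable_on X"
    \<comment> \<open>For a fixed interval, the gap probabilities are the terms of the given sum
      with \<open>q - p\<close> as \<epsilon>.\<close>
    have "AE \<omega> in M. finite {x \<in> X. \<omega> \<in> Y x -` gap_configs p q \<inter> space M}" if "p < q" for p q
    proof (rule borel_cantelli_countable[OF \<open>countable X\<close>])
      show "Y x -` gap_configs p q \<inter> space M \<in> events" if "x \<in> X" for x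
        using P[OF that]
        by (intro measurable_sets[OF _ sets_gap_configs]) (simp add: poisson_process_def)
      have "(\<lambda>x. exp (- l x * (q - p))) summable_on X" using sum that by simp
      then show "(\<lambda>x. prob (Y x -` gap_configs p q \<inter> space M)) summable_on X"
        using that by (simp add: gap_prob cong: summable_on_cong)
    qed
    \<comment> \<open>Rational endpoints leave only countably many exceptional null sets to
      combine.\<close>
    then have "AE \<omega> in M. \<forall>p\<in>\<rat>. \<forall>q\<in>\<rat>. p < q \<longrightarrow>
        finite {x \<in> X. \<omega> \<in> Y x -` gap_configs p q \<inter> space M}"
      by (intro AE_ball_countable' countable_rat) auto
    moreover have "AE \<omega> in M. \<forall>x\<in>X. Y x \<omega> \<noteq> {}"
      by (intro AE_ball_countable' \<open>countable X\<close> poisson_process_AE_nonempty[OF P assms(6)])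
    ultimately show "AE \<omega> in M. path_connected (V_set X (\<lambda>x. Y x \<omega>))"
      using AE_space
    proof eventually_elim
      case (elim \<omega>)
      have "{x \<in> X. Y x \<omega> \<inter> {p..q} = {}} = {x \<in> X. \<omega> \<in> Y x -` gap_configs p q \<inter> space M}" for p q
        using lf elim(3) by (auto simp: gap_configs_def)
      then have "finite {x \<in> X. Y x \<omega> \<inter> {p..q} = {}}" if "p \<in> \<rat>" "q \<in> \<rat>" "p < q" for p q
        using elim(1) that by simp
      then show ?case
        using elim lf \<open>countable X\<close>
        by (intro path_connected_V_set closed_locally_finite finite_infdist_gt) auto
    qed
  next
    assume "\<not> (\<forall>\<epsilon>>0. (\<lambda>x. exp (- l x * \<epsilon>)) summable_on X)"
    then obtain \<epsilon> where \<epsilon>: "\<epsilon> > 0" "\<not> (\<lambda>x. exp (- l x * \<epsilon>)) summable_on X" by blast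
    from not_summable_on_one_sided[OF \<open>bounded X\<close> \<epsilon>(2)] obtain c s where s: "\<bar>s\<bar> = 1"
      "\<And>d. d > 0 \<Longrightarrow> \<not> (\<lambda>x. exp (- l x * \<epsilon>)) summable_on {x \<in> X. 0 < s * (x - c) \<and> s * (x - c) < d}"
      by blast
    \<comment> \<open>The interval has length \<epsilon>, so its gap probabilities are exactly the
      terms whose sum diverges over every such one-sided neighbourhood of \<open>c\<close>.\<close>
    have "AE \<omega> in M. \<exists>x\<in>{x \<in> X. 0 < s * (x - c) \<and> s * (x - c) < d}.
        Y x \<omega> \<in> gap_configs (r - \<epsilon> / 2) (r + \<epsilon> / 2)" if "d > 0" for r d
    proof (rule indep_vars_AE_hit)
      show "indep_vars (\<lambda>_. config_space) Y {x \<in> X. 0 < s * (x - c) \<and> s * (x - c) < d}"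
        by (rule indep_vars_subset[OF assms(8)]) auto
      have "prob (Y x -` gap_configs (r - \<epsilon> / 2) (r + \<epsilon> / 2) \<inter> space M) = exp (- l x * \<epsilon>)"
        if "x \<in> X" for x
        using gap_prob[OF that, of "r - \<epsilon> / 2" "r + \<epsilon> / 2"] \<open>\<epsilon> > 0\<close> by simp
      then have "(\<lambda>x. prob (Y x -` gap_configs (r - \<epsilon> / 2) (r + \<epsilon> / 2) \<inter> space M)) summable_on
          {x \<in> X. 0 < s * (x - c) \<and> s * (x - c) < d} \<longleftrightarrow>
          (\<lambda>x. exp (- l x * \<epsilon>)) summable_on {x \<in> X. 0 < s * (x - c) \<and> s * (x - c) < d}"
        by (intro summable_on_cong) auto
      then show "\<not> (\<lambda>x. prob (Y x -` gap_configs (r - \<epsilon> / 2) (r + \<epsilon> / 2) \<inter> space M)) summable_on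
          {x \<in> X. 0 < s * (x - c) \<and> s * (x - c) < d}"
        using s(2)[OF that] by simp
    qed (rule sets_gap_configs)
    then have "AE \<omega> in M. \<forall>r\<in>\<rat>. \<forall>d\<in>\<rat>. d > 0 \<longrightarrow>
        (\<exists>x\<in>{x \<in> X. 0 < s * (x - c) \<and> s * (x - c) < d}. Y x \<omega> \<in> gap_configs (r - \<epsilon> / 2) (r + \<epsilon> / 2))"
      by (intro AE_ball_countable' countable_rat) auto
    then show "AE \<omega> in M. \<not> path_connected (V_set X (\<lambda>x. Y x \<omega>))"
    proof eventually_elim
      case (elim \<omega>)
      \<comment> \<open>Half of the half-width \<epsilon>/2 is given up: a rational centre within
        \<epsilon>/4 of an arbitrary height \<open>y\<close> still leaves a gap of half-width
        \<epsilon>/4 around \<open>y\<close>.\<close>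
      show ?case
      proof (rule not_path_connected_V_set[OF \<open>countable X\<close> s(1), of "\<epsilon> / 4"])
        show "\<epsilon> / 4 > 0" using \<open>\<epsilon> > 0\<close> by simp
        fix y d :: real assume "d > 0"
        obtain r where r: "r \<in> \<rat>" "y - \<epsilon> / 4 < r" "r < y + \<epsilon> / 4"
          using Rats_dense_in_real[of "y - \<epsilon> / 4" "y + \<epsilon> / 4"] \<open>\<epsilon> > 0\<close> by auto
        obtain d' where d': "d' \<in> \<rat>" "0 < d'" "d' < d"
          using Rats_dense_in_real[OF \<open>d > 0\<close>] by auto
        obtain x where x: "x \<in> X" "0 < s * (x - c)" "s * (x - c) < d'"
            "Y x \<omega> \<inter> {r - \<epsilon> / 2..r + \<epsilon> / 2} = {}"
          using elim[rule_format, OF r(1) d'(1,2)] by (auto simp: gap_configs_def)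
        have "{y - \<epsilon> / 4..y + \<epsilon> / 4} \<subseteq> {r - \<epsilon> / 2..r + \<epsilon> / 2}" using r by auto
        then have "Y x \<omega> \<inter> {y - \<epsilon> / 4..y + \<epsilon> / 4} = {}" using x(4) by blast
        then show "\<exists>x\<in>X. 0 < s * (x - c) \<and> s * (x - c) < d \<and> Y x \<omega> \<inter> {y - \<epsilon> / 4..y + \<epsilon> / 4} = {}"
          using x d' by (intro bexI[of _ x]) auto
      qed
    qed
  }
qed

end
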